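(* Let $G$ be a connected graph. Then the following statements are equivalent: (A1) $G$ is $\{P_4, C_4, \text{paw}, \text{diamond}\}$-free; (A2) every graph search ordering of $G$ is a DFS ordering of $G$; (A3) every graph search ordering of $G$ is a BFS ordering of $G$; (A4) an ordering of $V(G)$ is a BFS ordering of $G$ if and only if it is a DFS ordering of $G$.
   Context: All graphs are finite and simple. For an ordering $\sigma$ of $V(G)$ write $x<_\sigma y$ if $x$ precedes $y$ in $\sigma$. A graph search (generic search) ordering of $G$ is an ordering of $V(G)$ such that every prefix induces a connected subgraph. An ordering $\sigma$ of $V(G)$ is a BFS ordering if whenever $a<_\sigma b<_\sigma c$, $ac\in E(G)$ and $ab\notin E(G)$, there is a vertex $d$ with $d<_\sigma a$ and $db\in E(G)$. It is a DFS ordering if whenever $a<_\sigma b<_\sigma c$, $ac\in E(G)$ and $ab\notin E(G)$, there is a vertex $d$ with $a<_\sigma d<_\sigma b$ and $db\in E(G)$. The paw is the graph consisting of a triangle plus one extra vertex adjacent to exactly one vertex of the triangle; the diamond is $K_4$ minus one edge. $G$ is $\mathcal{F}$-free if it contains no induced subgraph isomorphic to a member of $\mathcal{F}$. *)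

theory Defs
  imports "Graph_Theory.Graph_Theory"
begin

text \<open>
  Finite simple graphs are \<open>pair_graph\<close>s: finite, loop-free, symmetric sets of vertex pairs, so an
  edge \<open>xy\<close> is present as both \<open>(x, y)\<close> and \<open>(y, x)\<close>. An ordering of the vertices is a list that
  enumerates them without repetition.
\<close>

definition vertex_ordering :: "'a pair_pre_digraph \<Rightarrow> 'a list \<Rightarrow> bool" where
  "vertex_ordering G \<sigma> \<longleftrightarrow> distinct \<sigma> \<and> set \<sigma> = pverts G"

definition precedes :: "'a list \<Rightarrow> 'a \<Rightarrow> 'a \<Rightarrow> bool" where
  "precedes \<sigma> x y \<longleftrightarrow> (\<exists>i j. i < j \<and> j < length \<sigma> \<and> \<sigma> ! i = x \<and> \<sigma> ! j = y)"

text \<open>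
  The empty prefix is left out below because \<^const>\<open>connected\<close> requires a nonempty vertex set.
\<close>

definition search_ordering :: "'a pair_pre_digraph \<Rightarrow> 'a list \<Rightarrow> bool" where
  "search_ordering G \<sigma> \<longleftrightarrow> vertex_ordering G \<sigma> \<and>
     (\<forall>k. 1 \<le> k \<and> k \<le> length \<sigma> \<longrightarrow> connected (with_proj G \<restriction> set (take k \<sigma>)))"

definition bfs_ordering :: "'a pair_pre_digraph \<Rightarrow> 'a list \<Rightarrow> bool" where
  "bfs_ordering G \<sigma> \<longleftrightarrow> vertex_ordering G \<sigma> \<and>
     (\<forall>a b c. precedes \<sigma> a b \<and> precedes \<sigma> b c \<and> (a, c) \<in> parcs G \<and> (a, b) \<notin> parcs G \<longrightarrow>
        (\<exists>d. precedes \<sigma> d a \<and> (d, b) \<in> parcs G))"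

definition dfs_ordering :: "'a pair_pre_digraph \<Rightarrow> 'a list \<Rightarrow> bool" where
  "dfs_ordering G \<sigma> \<longleftrightarrow> vertex_ordering G \<sigma> \<and>
     (\<forall>a b c. precedes \<sigma> a b \<and> precedes \<sigma> b c \<and> (a, c) \<in> parcs G \<and> (a, b) \<notin> parcs G \<longrightarrow>
        (\<exists>d. precedes \<sigma> a d \<and> precedes \<sigma> d b \<and> (d, b) \<in> parcs G))"

definition graph_of_edges :: "'a set \<Rightarrow> 'a rel \<Rightarrow> 'a pair_pre_digraph" where
  "graph_of_edges V E = \<lparr> pverts = V, parcs = E \<union> E\<inverse> \<rparr>"

definition P4_graph :: "nat pair_pre_digraph" where
  "P4_graph = graph_of_edges {0, 1, 2, 3} {(0, 1), (1, 2), (2, 3)}"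

definition C4_graph :: "nat pair_pre_digraph" where
  "C4_graph = graph_of_edges {0, 1, 2, 3} {(0, 1), (1, 2), (2, 3), (3, 0)}"

definition paw_graph :: "nat pair_pre_digraph" where
  "paw_graph = graph_of_edges {0, 1, 2, 3} {(0, 1), (1, 2), (2, 0), (0, 3)}"

definition diamond_graph :: "nat pair_pre_digraph" where
  "diamond_graph = graph_of_edges {0, 1, 2, 3} {(0, 1), (0, 2), (0, 3), (1, 2), (1, 3)}"

definition free_of :: "'b pair_pre_digraph set \<Rightarrow> 'a pair_pre_digraph \<Rightarrow> bool" where
  "free_of \<F> G \<longleftrightarrow>
     \<not> (\<exists>F \<in> \<F>. \<exists>H. induced_subgraph H (with_proj G) \<and> digraph_iso H (with_proj F))"

end

theory Submission
  imports Defs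
begin

text \<open>
  All four forbidden graphs arise from one pattern: distinct vertices \<open>u, x, y, z\<close> with edges
  \<open>ux, uy, xz\<close> and non-edge \<open>xy\<close>; the status of \<open>uz\<close> and \<open>yz\<close> decides which of the four it is.

  If a search ordering has \<open>a < b < c\<close> with \<open>ac\<close> an edge and \<open>ab\<close> not, then an edge leaving the
  closed neighbourhood of \<open>a\<close> inside the connected prefix ending in \<open>b\<close> gives an induced path
  \<open>a u y\<close>, which together with \<open>c\<close> forms the pattern. So without the pattern the BFS and DFS
  conditions hold vacuously for every search ordering; conversely, on a connected graph BFS and DFS
  orderings are always search orderings.

  With the pattern, a BFS ordering that starts with \<open>u, x, y\<close> is not a DFS ordering, and a search
  ordering that starts with \<open>x, u, y\<close> is not a BFS ordering, in both cases because of
  \<open>x < y < z\<close>.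
\<close>

definition extendable_cherry :: "'a pair_pre_digraph \<Rightarrow> 'a \<Rightarrow> 'a \<Rightarrow> 'a \<Rightarrow> 'a \<Rightarrow> bool" where
  "extendable_cherry G u x y z \<longleftrightarrow> distinct [u, x, y, z] \<and>
     (u, x) \<in> parcs G \<and> (u, y) \<in> parcs G \<and> (x, z) \<in> parcs G \<and> (x, y) \<notin> parcs G"

lemma parcs_sym:
  assumes "pair_graph G"
  shows "(x, y) \<in> parcs G \<longleftrightarrow> (y, x) \<in> parcs G"
proof -
  interpret pair_graph G by fact
  show ?thesis using pair_sym_arcs by (auto simp: symmetric_def dest: symD)
qed

lemma parcs_in_pverts:
  assumes "pair_graph G" "(x, y) \<in> parcs G"
  shows "x \<in> pverts G" "y \<in> pverts G" "x \<noteq> y"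
proof -
  interpret pair_graph G by fact
  show "x \<in> pverts G" "y \<in> pverts G" "x \<noteq> y"
    using in_arcsD1[OF assms(2)] in_arcsD2[OF assms(2)] pair_no_loops[OF assms(2)] by auto
qed

subsection \<open>Induced copies\<close>

text \<open>Replaces the isomorphism by an embedding \<open>g\<close> of \<open>F\<close> into
  \<open>G\<close> that preserves and reflects adjacency. Arcs are pairs of vertices, so an
  isomorphism is determined by its vertex map; \<open>g\<close> is the inverse of that map.\<close>

lemma induced_copy_iff:
  assumes "pair_wf_digraph G" "pair_wf_digraph F"
  shows "(\<exists>H. induced_subgraph H (with_proj G) \<and> digraph_iso H (with_proj F)) \<longleftrightarrow>
    (\<exists>g. inj_on g (pverts F) \<and> g ` pverts F \<subseteq> pverts G \<and>
      (\<forall>a\<in>pverts F. \<forall>b\<in>pverts F. (g a, g b) \<in> parcs G \<longleftrightarrow> (a, b) \<in> parcs F))"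
    (is "?L \<longleftrightarrow> ?R")
proof
  assume ?L
  then obtain H f where H: "induced_subgraph H (with_proj G)"
    and f: "pre_digraph.digraph_isomorphism H f" and F: "with_proj F = app_iso f H"
    by (auto simp: digraph_iso_def)
  interpret H: wf_digraph H using H by (auto simp: induced_subgraph_def subgraph_def)
  have ht [simp]: "tail H = fst" "head H = snd"
    and VH: "verts H \<subseteq> pverts G"
    and EH: "arcs H = {e \<in> parcs G. fst e \<in> verts H \<and> snd e \<in> verts H}"
    using H by (auto simp: induced_subgraph_def subgraph_def compatible_def)
  have VF: "pverts F = iso_verts f ` verts H"
    using arg_cong[OF F, of verts] by simp
  \<comment> \<open>\<open>H\<close> inherits \<open>fst\<close> and \<open>snd\<close> from
    \<open>G\<close>, so its arcs are their own end pairs. Comparing \<open>arcs_ends\<close> on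
    both sides of \<open>F\<close> then expresses \<open>parcs F\<close> through
    \<open>iso_verts f\<close> alone.\<close>
  have ends: "arcs_ends H = arcs H" by (auto simp: arcs_ends_def arc_to_ends_def)
  have EF: "parcs F = (\<lambda>(u, v). (iso_verts f u, iso_verts f v)) ` arcs H"
    using arg_cong[OF F, of arcs_ends] H.arcs_ends_app_iso_eq[OF f] ends by simp
  have inj: "inj_on (iso_verts f) (verts H)"
    using f by (rule H.digraph_isomorphism_inj_on_verts)
  define g where "g = the_inv_into (verts H) (iso_verts f)"
  have gf: "g (iso_verts f v) = v" if "v \<in> verts H" for v
    using that inj by (simp add: g_def the_inv_into_f_f)
  have "inj_on g (pverts F)" unfolding VF by (auto intro!: inj_onI simp: gf)
  moreover have "g ` pverts F \<subseteq> pverts G" using VH by (auto simp: VF gf)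
  moreover have "(u, v) \<in> parcs G \<longleftrightarrow> (iso_verts f u, iso_verts f v) \<in> parcs F"
    if uv: "u \<in> verts H" "v \<in> verts H" for u v
  proof
    assume "(u, v) \<in> parcs G"
    then have "(u, v) \<in> arcs H" using uv by (simp add: EH)
    then show "(iso_verts f u, iso_verts f v) \<in> parcs F" unfolding EF by force
  next
    assume "(iso_verts f u, iso_verts f v) \<in> parcs F"
    then obtain u' v' where "(u', v') \<in> arcs H" "iso_verts f u = iso_verts f u'"
      "iso_verts f v = iso_verts f v'" unfolding EF by auto
    then show "(u, v) \<in> parcs G" using uv inj by (auto simp: EH dest: inj_onD)
  qed
  ultimately show ?R by (intro exI[of _ g]) (auto simp: VF gf)
next
  assume ?R
  then obtain g where inj: "inj_on g (pverts F)" and gV: "g ` pverts F \<subseteq> pverts G"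
    and gE: "\<And>a b. a \<in> pverts F \<Longrightarrow> b \<in> pverts F \<Longrightarrow> (g a, g b) \<in> parcs G \<longleftrightarrow> (a, b) \<in> parcs F"
    by blast
  interpret G: pair_wf_digraph G by fact
  interpret F: pair_wf_digraph F by fact
  define S where "S = g ` pverts F"
  define H where "H = with_proj G \<restriction> S"
  define h where "h = the_inv_into (pverts F) g"
  have hg: "h (g a) = a" if "a \<in> pverts F" for a
    using that inj by (simp add: h_def the_inv_into_f_f)
  \<comment> \<open>The inverse of \<open>g\<close> on vertices, applied componentwise to arcs, maps
    the subgraph induced on the image of \<open>g\<close> onto \<open>F\<close>.\<close>
  define f where "f = \<lparr>iso_verts = h, iso_arcs = map_prod h h, iso_head = snd, iso_tail = fst\<rparr>"
  have HG: "induced_subgraph H (with_proj G)"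
    unfolding H_def using gV by (intro G.induced_induce) (auto simp: S_def)
  have EH: "arcs H = map_prod g g ` parcs F"
  proof (intro subset_antisym subsetI)
    fix e assume "e \<in> arcs H"
    then obtain a b where "e = (g a, g b)" "a \<in> pverts F" "b \<in> pverts F" "(g a, g b) \<in> parcs G"
      by (cases e) (auto simp: H_def S_def)
    then show "e \<in> map_prod g g ` parcs F" using gE by (auto intro!: image_eqI[of _ _ "(a, b)"])
  next
    fix e assume "e \<in> map_prod g g ` parcs F"
    then obtain a b where "e = (g a, g b)" "(a, b) \<in> parcs F" by auto
    then show "e \<in> arcs H"
      using gE F.in_arcsD1[of a b] F.in_arcsD2[of a b] by (auto simp: H_def S_def)
  qed
  have "wf_digraph H" using HG by (auto simp: induced_subgraph_def subgraph_def)
  moreover have "inj_on h S" by (auto simp: S_def hg intro!: inj_onI)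
  moreover from this have "inj_on (map_prod h h) (arcs H)"
    using map_prod_inj_on[of h S h S] by (rule_tac inj_on_subset) (auto simp: H_def)
  ultimately have "pre_digraph.digraph_isomorphism H f"
    by (auto simp: pre_digraph.digraph_isomorphism_def f_def H_def)
  moreover have "h ` S = pverts F" by (force simp: S_def hg)
  moreover have "map_prod h h ` arcs H = parcs F"
  proof -
    have "map_prod h h (map_prod g g e) = e" if "e \<in> parcs F" for e
      using that F.in_arcsD1[of "fst e" "snd e"] F.in_arcsD2[of "fst e" "snd e"]
      by (cases e) (simp add: hg)
    then show ?thesis by (simp add: EH image_image)
  qed
  ultimately have "digraph_iso H (with_proj F)"
    unfolding digraph_iso_def
    by (intro exI[of _ f]) (auto simp: f_def app_iso_def with_proj_def H_def)
  with HG show ?L by blast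
qed

lemmas forbidden_graph_defs =
  P4_graph_def C4_graph_def paw_graph_def diamond_graph_def graph_of_edges_def

lemma forbidden_graphs_wf:
  assumes "F \<in> {P4_graph, C4_graph, paw_graph, diamond_graph}"
  shows "pair_wf_digraph F"
  using assms by unfold_locales (auto simp: forbidden_graph_defs)

text \<open>The four graphs share the vertices 0 to 3 and are symmetric and irreflexive, so an
  embedding amounts to four distinct vertices with the right adjacency on six unordered
  pairs.\<close>

lemma induced_copy_forbidden_iff:
  assumes "pair_graph G" "F \<in> {P4_graph, C4_graph, paw_graph, diamond_graph}"
  shows "(\<exists>H. induced_subgraph H (with_proj G) \<and> digraph_iso H (with_proj F)) \<longleftrightarrow>
    (\<exists>p q r s. distinct [p, q, r, s] \<and> {p, q, r, s} \<subseteq> pverts G \<and>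
      ((p, q) \<in> parcs G \<longleftrightarrow> (0, 1) \<in> parcs F) \<and> ((p, r) \<in> parcs G \<longleftrightarrow> (0, 2) \<in> parcs F) \<and>
      ((p, s) \<in> parcs G \<longleftrightarrow> (0, 3) \<in> parcs F) \<and> ((q, r) \<in> parcs G \<longleftrightarrow> (1, 2) \<in> parcs F) \<and>
      ((q, s) \<in> parcs G \<longleftrightarrow> (1, 3) \<in> parcs F) \<and> ((r, s) \<in> parcs G \<longleftrightarrow> (2, 3) \<in> parcs F))"
    (is "_ \<longleftrightarrow> ?R")
proof -
  interpret pair_graph G by fact
  have V: "pverts F = {0, 1, 2, 3}" and symF: "\<And>a b. (a, b) \<in> parcs F \<longleftrightarrow> (b, a) \<in> parcs F"
    and irr: "\<And>a. (a, a) \<notin> parcs F"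
    using assms(2) by (auto simp: forbidden_graph_defs)
  have irrG: "\<And>a. (a, a) \<notin> parcs G" using parcs_in_pverts[OF assms(1)] by blast
  have "(\<exists>g. inj_on g (pverts F) \<and> g ` pverts F \<subseteq> pverts G \<and>
      (\<forall>a\<in>pverts F. \<forall>b\<in>pverts F. (g a, g b) \<in> parcs G \<longleftrightarrow> (a, b) \<in> parcs F)) \<longleftrightarrow> ?R"
    (is "?L \<longleftrightarrow> _")
  proof
    assume ?L
    then obtain g where "inj_on g (pverts F)" "g ` pverts F \<subseteq> pverts G"
      "\<forall>a\<in>pverts F. \<forall>b\<in>pverts F. (g a, g b) \<in> parcs G \<longleftrightarrow> (a, b) \<in> parcs F" by blast
    then show ?R unfolding V
      by (intro exI[of _ "g 0"] exI[of _ "g 1"] exI[of _ "g 2"] exI[of _ "g 3"]) simp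
  next
    assume ?R
    then obtain p q r s where pqrs: "distinct [p, q, r, s]" "{p, q, r, s} \<subseteq> pverts G"
      "(p, q) \<in> parcs G \<longleftrightarrow> (0, 1) \<in> parcs F" "(p, r) \<in> parcs G \<longleftrightarrow> (0, 2) \<in> parcs F"
      "(p, s) \<in> parcs G \<longleftrightarrow> (0, 3) \<in> parcs F" "(q, r) \<in> parcs G \<longleftrightarrow> (1, 2) \<in> parcs F"
      "(q, s) \<in> parcs G \<longleftrightarrow> (1, 3) \<in> parcs F" "(r, s) \<in> parcs G \<longleftrightarrow> (2, 3) \<in> parcs F"
      by blast
    define g where "g = (\<lambda>i::nat. if i = 0 then p else if i = 1 then q else if i = 2 then r else s)"
    have g: "g 0 = p" "g 1 = q" "g 2 = r" "g 3 = s" by (auto simp: g_def)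
    have pqrs': "(q, p) \<in> parcs G \<longleftrightarrow> (1, 0) \<in> parcs F" "(r, p) \<in> parcs G \<longleftrightarrow> (2, 0) \<in> parcs F"
      "(s, p) \<in> parcs G \<longleftrightarrow> (3, 0) \<in> parcs F" "(r, q) \<in> parcs G \<longleftrightarrow> (2, 1) \<in> parcs F"
      "(s, q) \<in> parcs G \<longleftrightarrow> (3, 1) \<in> parcs F" "(s, r) \<in> parcs G \<longleftrightarrow> (3, 2) \<in> parcs F"
      using pqrs(3-8) parcs_sym[OF assms(1)] symF by metis+
    show ?L
    proof (intro exI[of _ g] conjI)
      show "inj_on g (pverts F)" unfolding V using pqrs(1)
        by (auto simp: g_def)
      show "g ` pverts F \<subseteq> pverts G" unfolding V using pqrs(2) by (simp only: image_insert g) auto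
      show "\<forall>a\<in>pverts F. \<forall>b\<in>pverts F. (g a, g b) \<in> parcs G \<longleftrightarrow> (a, b) \<in> parcs F"
        unfolding V using pqrs(3-) pqrs' irr irrG by (simp only: ball_simps g)
    qed
  qed
  then show ?thesis
    using induced_copy_iff[OF _ forbidden_graphs_wf[OF assms(2)], of G] pair_wf_digraph_axioms by simp
qed

text \<open>Of the two undetermined pairs \<open>uz\<close> and \<open>yz\<close>, neither being an
  edge gives \<open>P4_graph\<close>, only \<open>yz\<close> gives \<open>C4_graph\<close>, only
  \<open>uz\<close> gives \<open>paw_graph\<close>, and both give
  \<open>diamond_graph\<close>.\<close>

lemma not_free_iff_extendable_cherry:
  assumes "pair_graph G"
  shows "\<not> free_of {P4_graph, C4_graph, paw_graph, diamond_graph} G \<longleftrightarrow>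
    (\<exists>u x y z. extendable_cherry G u x y z)"
    (is "?L \<longleftrightarrow> ?R")
proof
  note sym = parcs_sym[OF assms] and copy = induced_copy_forbidden_iff[OF assms]
  {
    assume ?L
    then obtain F where F: "F \<in> {P4_graph, C4_graph, paw_graph, diamond_graph}"
      and "\<exists>H. induced_subgraph H (with_proj G) \<and> digraph_iso H (with_proj F)"
      unfolding free_of_def by blast
    then obtain p q r s where *: "distinct [p, q, r, s]"
      "(p, q) \<in> parcs G \<longleftrightarrow> (0, 1) \<in> parcs F" "(p, r) \<in> parcs G \<longleftrightarrow> (0, 2) \<in> parcs F"
      "(p, s) \<in> parcs G \<longleftrightarrow> (0, 3) \<in> parcs F" "(q, r) \<in> parcs G \<longleftrightarrow> (1, 2) \<in> parcs F"
      "(q, s) \<in> parcs G \<longleftrightarrow> (1, 3) \<in> parcs F" "(r, s) \<in> parcs G \<longleftrightarrow> (2, 3) \<in> parcs F"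
      unfolding copy[OF F] by blast
    from F consider "F = P4_graph \<or> F = C4_graph" | "F = paw_graph" | "F = diamond_graph" by blast
    \<comment> \<open>In the path and the cycle the centre is an inner vertex of the path 0-1-2-3.
      In the paw, \<open>y\<close> is the pendant vertex \<open>s\<close>; in the diamond,
      \<open>x\<close> and \<open>y\<close> are the nonadjacent vertices \<open>r\<close> and
      \<open>s\<close>.\<close>
    then have "extendable_cherry G q r p s \<or> extendable_cherry G p q s r
      \<or> extendable_cherry G p r s q"
    proof cases
      case 1
      then have "extendable_cherry G q r p s" using * sym[of q p] sym[of r p]
        by (auto simp: extendable_cherry_def forbidden_graph_defs)
      then show ?thesis by blast
    next
      case 2
      then have "extendable_cherry G p q s r" using *
        by (auto simp: extendable_cherry_def forbidden_graph_defs)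
      then show ?thesis by blast
    next
      case 3
      then have "extendable_cherry G p r s q" using * sym[of r q]
        by (auto simp: extendable_cherry_def forbidden_graph_defs)
      then show ?thesis by blast
    qed
    then show ?R by blast
  }
  {
    assume ?R
    then obtain u x y z where *: "extendable_cherry G u x y z" by blast
    then have V: "{u, x, y, z} \<subseteq> pverts G"
      using parcs_in_pverts[OF assms] by (auto simp: extendable_cherry_def)
    have copyI: "?L"
      if F: "F \<in> {P4_graph, C4_graph, paw_graph, diamond_graph}"
        and "distinct [p, q, r, s]" "{p, q, r, s} \<subseteq> pverts G"
        "(p, q) \<in> parcs G \<longleftrightarrow> (0, 1) \<in> parcs F" "(p, r) \<in> parcs G \<longleftrightarrow> (0, 2) \<in> parcs F"
        "(p, s) \<in> parcs G \<longleftrightarrow> (0, 3) \<in> parcs F" "(q, r) \<in> parcs G \<longleftrightarrow> (1, 2) \<in> parcs F"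
        "(q, s) \<in> parcs G \<longleftrightarrow> (1, 3) \<in> parcs F" "(r, s) \<in> parcs G \<longleftrightarrow> (2, 3) \<in> parcs F"
      for F p q r s
    proof -
      have "\<exists>H. induced_subgraph H (with_proj G) \<and> digraph_iso H (with_proj F)"
        unfolding copy[OF F] using that(2-) by blast
      with F show ?L unfolding free_of_def by blast
    qed
    consider "(u, z) \<notin> parcs G" "(y, z) \<notin> parcs G" | "(u, z) \<notin> parcs G" "(y, z) \<in> parcs G"
      | "(u, z) \<in> parcs G" "(y, z) \<notin> parcs G" | "(u, z) \<in> parcs G" "(y, z) \<in> parcs G" by blast
    then show ?L
    proof cases
      case 1
      then show ?thesis using * V sym[of y u] sym[of y x]
        by (intro copyI[of P4_graph y u x z])
          (auto simp: extendable_cherry_def forbidden_graph_defs)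
    next
      case 2
      then show ?thesis using * V sym[of y u] sym[of y x]
        by (intro copyI[of C4_graph y u x z])
          (auto simp: extendable_cherry_def forbidden_graph_defs)
    next
      case 3
      then show ?thesis using * V sym[of z y]
        by (intro copyI[of paw_graph u x z y])
          (auto simp: extendable_cherry_def forbidden_graph_defs)
    next
      case 4
      then show ?thesis using * V sym[of z x] sym[of z y]
        by (intro copyI[of diamond_graph u z x y])
          (auto simp: extendable_cherry_def forbidden_graph_defs)
    qed
  }
qed

subsection \<open>Connectedness and search orderings\<close>

text \<open>If no arc left \<open>S\<close>, induction along a walk from \<open>a\<close> would put
  \<open>b\<close> in \<open>S\<close>. Symmetry of \<open>H\<close> turns reachability in the
  symmetric closure, which \<open>connected\<close> provides, into reachability along arcs.\<close>

lemma connected_cut_edge: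
  assumes "connected H" "symmetric H" "a \<in> S" "a \<in> verts H" "b \<in> verts H" "b \<notin> S"
  shows "\<exists>u v. u \<in> S \<and> u \<in> verts H \<and> v \<in> verts H \<and> v \<notin> S \<and> (u, v) \<in> arcs_ends H"
proof (rule ccontr)
  assume no: "\<not> ?thesis"
  have sym: "symcl (arcs_ends H) = arcs_ends H"
    using assms(2) by (auto simp: symcl_def symmetric_def dest: symD)
  have "(a, b) \<in> rtrancl_on (verts H) (arcs_ends H)"
    using assms unfolding connected_conv sym by blast
  then have "b \<in> S" using assms(3) no by induct auto
  with assms(6) show False by blast
qed

lemma arcs_ends_restrict: "arcs_ends (with_proj G \<restriction> S) = parcs G \<inter> S \<times> S"
  by (auto simp: arcs_ends_def arc_to_ends_def)

lemma restrict_cut_edge: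
  assumes "pair_graph G" "connected (with_proj G \<restriction> T)" "a \<in> S" "a \<in> T" "b \<in> T" "b \<notin> S"
  shows "\<exists>u v. u \<in> S \<and> u \<in> T \<and> v \<in> T \<and> v \<notin> S \<and> (u, v) \<in> parcs G"
proof -
  have "symmetric (with_proj G \<restriction> T)"
    unfolding symmetric_def arcs_ends_restrict using parcs_sym[OF assms(1)] by (auto intro!: symI)
  from connected_cut_edge[OF assms(2) this assms(3), of b] show ?thesis
    using assms(4-6) by (auto simp: arcs_ends_restrict)
qed

lemma cut_edge:
  assumes "pair_graph G" "connected (with_proj G)" "a \<in> S" "a \<in> pverts G" "b \<in> pverts G" "b \<notin> S"
  shows "\<exists>u v. u \<in> S \<and> v \<in> pverts G - S \<and> (u, v) \<in> parcs G"
proof -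
  interpret pair_graph G by fact
  show ?thesis
    using connected_cut_edge[OF assms(2) pair_sym_arcs assms(3), of b] assms(4-6) by auto
qed

section \<open>Connected prefixes from earlier neighbours\<close>

text \<open>A local substitute for connectedness of all prefixes. The list may omit vertices, so the
  property can serve as the invariant of a greedy construction.\<close>

definition attached_list :: "'a pair_pre_digraph \<Rightarrow> 'a list \<Rightarrow> bool" where
  "attached_list G \<tau> \<longleftrightarrow> distinct \<tau> \<and> set \<tau> \<subseteq> pverts G \<and>
     (\<forall>j. 0 < j \<and> j < length \<tau> \<longrightarrow> (\<exists>i<j. (\<tau> ! i, \<tau> ! j) \<in> parcs G))"

text \<open>Induction on the prefix length: walks in the old prefix survive, and the new vertex is
  joined to it by the edge to its earlier neighbour.\<close>

lemma attached_connected: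
  assumes "pair_graph G" "attached_list G \<sigma>" "1 \<le> k" "k \<le> length \<sigma>"
  shows "connected (with_proj G \<restriction> set (take k \<sigma>))"
  using assms(3,4)
proof (induction k rule: dec_induct)
  case base
  then show ?case by (cases \<sigma>) (auto simp: connected_conv)
next
  case (step k)
  define T where "T = set (take k \<sigma>)"
  define R where "R = (\<lambda>S. symcl (parcs G \<inter> S \<times> S))"
  have T': "set (take (Suc k) \<sigma>) = insert (\<sigma> ! k) T"
    using step by (simp add: T_def take_Suc_conv_app_nth)
  obtain i where i: "i < k" "(\<sigma> ! i, \<sigma> ! k) \<in> parcs G"
    using assms(2) step unfolding attached_list_def by (metis Suc_le_lessD not_one_le_zero gr_zeroI)
  have iT: "\<sigma> ! i \<in> T" using i step by (auto simp: T_def in_set_conv_nth)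
  let ?T' = "insert (\<sigma> ! k) T"
  let ?C = "rtrancl_on ?T' (R ?T')"
  have old: "(u, v) \<in> ?C" if "u \<in> T" "v \<in> T" for u v
  proof -
    have "(u, v) \<in> rtrancl_on T (R T)"
      using step.IH step.prems that
      by (simp add: connected_conv arcs_ends_restrict T_def R_def)
    then show ?thesis by (rule rtrancl_on_mono[rotated 2]) (auto simp: R_def symcl_def)
  qed
  have symR: "sym (R ?T')" by (auto simp: R_def symcl_def intro!: symI)
  have "(\<sigma> ! i, \<sigma> ! k) \<in> R ?T'" using i iT by (auto simp: R_def symcl_def)
  then have new: "(\<sigma> ! i, \<sigma> ! k) \<in> ?C"
    using iT by (auto intro: rtrancl_on_into_rtrancl_on)
  \<comment> \<open>The earlier neighbour acts as a hub: any two vertices are connected by reversing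
    a walk from it to one and appending a walk from it to the other.\<close>
  have from_i: "(\<sigma> ! i, v) \<in> ?C" if "v \<in> ?T'" for v using that new old iT by auto
  have "(u, v) \<in> ?C" if "u \<in> ?T'" "v \<in> ?T'" for u v
    using from_i[OF that(1)] from_i[OF that(2)] rtrancl_on_sym[OF symR, of ?T']
    by (meson rtrancl_on_trans symD)
  then show ?case unfolding T' by (auto simp: connected_conv arcs_ends_restrict R_def)
qed

section \<open>Precedence in terms of positions\<close>

lemma nth_mem_take_iff:
  assumes "distinct \<sigma>" "i < length \<sigma>"
  shows "\<sigma> ! i \<in> set (take j \<sigma>) \<longleftrightarrow> i < j"
proof
  assume "\<sigma> ! i \<in> set (take j \<sigma>)"
  then obtain k where "k < j" "k < length \<sigma>" "\<sigma> ! k = \<sigma> ! i" by (auto simp: in_set_conv_nth)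
  then show "i < j" using assms by (simp add: nth_eq_iff_index_eq)
next
  assume "i < j"
  then show "\<sigma> ! i \<in> set (take j \<sigma>)"
    using assms(2) nth_mem[of i "take j \<sigma>"] by simp
qed

lemma precedes_nth:
  assumes "distinct \<sigma>" "i < length \<sigma>" "j < length \<sigma>"
  shows "precedes \<sigma> (\<sigma> ! i) (\<sigma> ! j) \<longleftrightarrow> i < j"
  using assms by (auto simp: precedes_def nth_eq_iff_index_eq)

lemma precedes_nth_right:
  assumes "distinct \<sigma>" "j < length \<sigma>"
  shows "precedes \<sigma> d (\<sigma> ! j) \<longleftrightarrow> (\<exists>i<j. d = \<sigma> ! i)"
  using assms by (auto simp: precedes_def nth_eq_iff_index_eq)

lemma precedesE:
  assumes "precedes \<sigma> x y"
  obtains i j where "i < j" "j < length \<sigma>" "x = \<sigma> ! i" "y = \<sigma> ! j"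
  using assms unfolding precedes_def by blast

lemma search_orderingI:
  assumes "pair_graph G" "vertex_ordering G \<sigma>"
    "\<And>j. 0 < j \<Longrightarrow> j < length \<sigma> \<Longrightarrow> \<exists>i<j. (\<sigma> ! i, \<sigma> ! j) \<in> parcs G"
  shows "search_ordering G \<sigma>"
proof -
  have "attached_list G \<sigma>"
    using assms(2,3) by (auto simp: attached_list_def vertex_ordering_def)
  from attached_connected[OF assms(1) this] show ?thesis
    using assms(2) by (simp add: search_ordering_def)
qed

text \<open>The hypothesis is the common weakening of the BFS and the DFS condition.\<close>

lemma search_ordering_if_earlier_neighbour:
  assumes G: "pair_graph G" "connected (with_proj G)" and \<sigma>: "vertex_ordering G \<sigma>"
    and nb: "\<And>a b c. precedes \<sigma> a b \<Longrightarrow> precedes \<sigma> b c \<Longrightarrow> (a, c) \<in> parcs G \<Longrightarrow>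
      (a, b) \<notin> parcs G \<Longrightarrow> \<exists>d. precedes \<sigma> d b \<and> (d, b) \<in> parcs G"
  shows "search_ordering G \<sigma>"
proof (rule search_orderingI[OF G(1) \<sigma>])
  fix j assume j: "0 < j" "j < length \<sigma>"
  have dist: "distinct \<sigma>" and V: "set \<sigma> = pverts G" using \<sigma> by (auto simp: vertex_ordering_def)
  define S where "S = set (take j \<sigma>)"
  have S: "\<sigma> ! i \<in> S \<longleftrightarrow> i < j" if "i < length \<sigma>" for i
    using that dist by (simp add: S_def nth_mem_take_iff)
  have len: "0 < length \<sigma>" using j by linarith
  have "\<sigma> ! 0 \<in> S" "\<sigma> ! 0 \<in> pverts G" "\<sigma> ! j \<in> pverts G" "\<sigma> ! j \<notin> S"
    using S[OF len] S[OF j(2)] j(1) nth_mem[OF len] nth_mem[OF j(2)] V by simp_all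
  \<comment> \<open>Connectedness of \<open>G\<close> gives an edge from the first \<open>j\<close>
    vertices to a vertex \<open>v\<close> at position \<open>j\<close> or later.\<close>
  from cut_edge[OF G this]
  obtain u v where uv: "u \<in> S" "v \<in> pverts G" "v \<notin> S" "(u, v) \<in> parcs G" by blast
  have "u \<in> set \<sigma>" using uv(1) by (auto simp: S_def dest: in_set_takeD)
  then obtain i where i: "i < length \<sigma>" "u = \<sigma> ! i" by (auto simp: in_set_conv_nth)
  obtain k where k: "k < length \<sigma>" "v = \<sigma> ! k" using uv(2) V by (metis in_set_conv_nth)
  have ij: "i < j" and jk: "j \<le> k" using S uv i k by auto
  show "\<exists>i<j. (\<sigma> ! i, \<sigma> ! j) \<in> parcs G"
  proof (rule ccontr)
    assume no: "\<not> ?thesis"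
    \<comment> \<open>If \<open>v\<close> stood at position \<open>j\<close>, then \<open>u\<close>
      would already be the neighbour sought. Hence \<open>u\<close>, the vertex at position
      \<open>j\<close>, and \<open>v\<close> form a triple to which \<open>nb\<close>
      applies.\<close>
    then have "j < k" "(\<sigma> ! i, \<sigma> ! j) \<notin> parcs G" using uv ij jk i k by (cases "j = k", auto)
    then obtain d where "precedes \<sigma> d (\<sigma> ! j)" "(d, \<sigma> ! j) \<in> parcs G"
      using nb[of "\<sigma> ! i" "\<sigma> ! j" "\<sigma> ! k"] uv ij i k j by (auto simp: precedes_nth[OF dist])
    then show False using no dist j
      by (auto elim!: precedesE simp: nth_eq_iff_index_eq)
  qed
qed

lemma bfs_imp_search_ordering:
  assumes "pair_graph G" "connected (with_proj G)" "bfs_ordering G \<sigma>"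
  shows "search_ordering G \<sigma>"
proof (rule search_ordering_if_earlier_neighbour[OF assms(1,2)])
  show \<sigma>: "vertex_ordering G \<sigma>" using assms(3) by (simp add: bfs_ordering_def)
  fix a b c assume *: "precedes \<sigma> a b" "precedes \<sigma> b c" "(a, c) \<in> parcs G" "(a, b) \<notin> parcs G"
  then obtain d where "precedes \<sigma> d a" "(d, b) \<in> parcs G"
    using assms(3) unfolding bfs_ordering_def by blast
  moreover have "precedes \<sigma> d b"
    using \<sigma> \<open>precedes \<sigma> d a\<close> *(1)
    by (auto elim!: precedesE simp: vertex_ordering_def nth_eq_iff_index_eq precedes_nth)
  ultimately show "\<exists>d. precedes \<sigma> d b \<and> (d, b) \<in> parcs G" by blast
qed

lemma dfs_imp_search_ordering:
  assumes "pair_graph G" "connected (with_proj G)" "dfs_ordering G \<sigma>"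
  shows "search_ordering G \<sigma>"
  using assms(3) unfolding dfs_ordering_def
  by (intro search_ordering_if_earlier_neighbour[OF assms(1,2)]) blast+

text \<open>The path \<open>a u y\<close> is found inside the prefix ending in \<open>b\<close>. As
  \<open>c\<close> comes after that prefix, it differs from \<open>u\<close> and \<open>y\<close>
  and extends the path at its end \<open>a\<close>.\<close>

lemma search_ordering_extendable_cherry:
  assumes G: "pair_graph G" and \<sigma>: "search_ordering G \<sigma>"
    and abc: "precedes \<sigma> a b" "precedes \<sigma> b c" "(a, c) \<in> parcs G" "(a, b) \<notin> parcs G"
  shows "\<exists>u y. extendable_cherry G u a y c"
proof -
  have dist: "distinct \<sigma>" using \<sigma> by (auto simp: search_ordering_def vertex_ordering_def)
  obtain i j k where ijk: "i < j" "j < k" "k < length \<sigma>" "a = \<sigma> ! i" "b = \<sigma> ! j" "c = \<sigma> ! k"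
    using abc(1,2) dist by (auto elim!: precedesE simp: nth_eq_iff_index_eq)
  \<comment> \<open>\<open>Suc j\<close> makes the prefix contain \<open>b\<close> itself, while
    \<open>c\<close> stays outside.\<close>
  define T where "T = set (take (Suc j) \<sigma>)"
  have T: "a \<in> T" "b \<in> T" "c \<notin> T"
    using ijk dist by (auto simp: T_def nth_mem_take_iff)
  have "connected (with_proj G \<restriction> T)"
    using \<sigma> ijk by (auto simp: search_ordering_def T_def)
  moreover have "a \<noteq> b" using ijk dist by (auto simp: nth_eq_iff_index_eq)
  ultimately obtain u y where uy: "u = a \<or> (a, u) \<in> parcs G" "u \<in> T" "y \<in> T" "y \<noteq> a"
    "(a, y) \<notin> parcs G" "(u, y) \<in> parcs G"
    using restrict_cut_edge[OF G, of T a "insert a {v. (a, v) \<in> parcs G}" b] T abc(4) by auto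
  \<comment> \<open>The case \<open>u = a\<close> is excluded, since \<open>y\<close> is adjacent to
    \<open>u\<close> but not to \<open>a\<close>.\<close>
  then have "(a, u) \<in> parcs G" by auto
  then have "extendable_cherry G u a y c"
    using uy T abc parcs_in_pverts[OF G] parcs_sym[OF G, of u a]
    by (auto simp: extendable_cherry_def)
  then show ?thesis by blast
qed

subsection \<open>Greedy extension of a prefix\<close>

text \<open>Induction on the number of vertices still missing. The invariant \<open>P\<close> is
  left abstract, so the same argument builds both search orderings and BFS orderings.\<close>

lemma extend_to_enumeration:
  assumes "finite V" "P \<tau>"
    and enum: "\<And>\<tau>. P \<tau> \<Longrightarrow> distinct \<tau> \<and> set \<tau> \<subseteq> V"
    and step: "\<And>\<tau>. P \<tau> \<Longrightarrow> set \<tau> \<noteq> V \<Longrightarrow> \<exists>v\<in>V - set \<tau>. P (\<tau> @ [v])"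
  shows "\<exists>\<rho>. P (\<tau> @ \<rho>) \<and> set (\<tau> @ \<rho>) = V"
  using assms(2)
proof (induction "card (V - set \<tau>)" arbitrary: \<tau> rule: less_induct)
  case less
  show ?case
  proof (cases "set \<tau> = V")
    case True
    with less.prems show ?thesis by (intro exI[of _ "[]"]) simp
  next
    case False
    with step[OF less.prems] obtain v where v: "v \<in> V - set \<tau>" "P (\<tau> @ [v])" by blast
    have "card (V - set (\<tau> @ [v])) < card (V - set \<tau>)"
      using v(1) assms(1) by (intro psubset_card_mono) auto
    from less.hyps[OF this v(2)] obtain \<rho> where "P ((\<tau> @ [v]) @ \<rho>)" "set ((\<tau> @ [v]) @ \<rho>) = V"
      by blast
    then show ?thesis by (intro exI[of _ "v # \<rho>"]) simp
  qed
qed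

lemma attached_list_extend:
  assumes G: "pair_graph G" "connected (with_proj G)" and \<tau>: "attached_list G \<tau>" "\<tau> \<noteq> []"
  shows "\<exists>\<rho>. search_ordering G (\<tau> @ \<rho>)"
proof -
  interpret pair_graph G by fact
  \<comment> \<open>The invariant carries nonemptiness because the cut edge needs a listed vertex to
    start from, here \<open>hd \<tau>\<close>.\<close>
  have "\<exists>\<rho>. (attached_list G (\<tau> @ \<rho>) \<and> \<tau> @ \<rho> \<noteq> []) \<and> set (\<tau> @ \<rho>) = pverts G"
  proof (rule extend_to_enumeration)
    fix \<tau> assume \<tau>: "attached_list G \<tau> \<and> \<tau> \<noteq> []" and ne: "set \<tau> \<noteq> pverts G"
    then obtain b where b: "b \<in> pverts G" "b \<notin> set \<tau>" by (auto simp: attached_list_def)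
    have "hd \<tau> \<in> set \<tau>" "hd \<tau> \<in> pverts G" using \<tau> by (auto simp: attached_list_def)
    from cut_edge[OF G this b] obtain u v
      where uv: "u \<in> set \<tau>" "v \<in> pverts G - set \<tau>" "(u, v) \<in> parcs G" by blast
    then obtain i where i: "i < length \<tau>" "u = \<tau> ! i" by (auto simp: in_set_conv_nth)
    have "\<exists>i<j. ((\<tau> @ [v]) ! i, (\<tau> @ [v]) ! j) \<in> parcs G"
      if j: "0 < j" "j < length (\<tau> @ [v])" for j
    proof (cases "j = length \<tau>")
      case True
      then show ?thesis using uv i by (intro exI[of _ i]) (auto simp: nth_append)
    next
      case False
      then obtain k where "k < j" "(\<tau> ! k, \<tau> ! j) \<in> parcs G"
        using j \<tau> by (auto simp: attached_list_def)
      then show ?thesis using False j by (intro exI[of _ k]) (auto simp: nth_append)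
    qed
    then show "\<exists>v\<in>pverts G - set \<tau>. attached_list G (\<tau> @ [v]) \<and> \<tau> @ [v] \<noteq> []"
      using uv \<tau> by (intro bexI[of _ v]) (auto simp: attached_list_def)
  qed (use \<tau> in \<open>auto simp: attached_list_def\<close>)
  then obtain \<rho> where "attached_list G (\<tau> @ \<rho>)" "set (\<tau> @ \<rho>) = pverts G" by blast
  then have "search_ordering G (\<tau> @ \<rho>)"
    by (intro search_orderingI[OF G(1)]) (auto simp: attached_list_def vertex_ordering_def)
  then show ?thesis by blast
qed

text \<open>
  In a prefix \<open>\<tau>\<close> of a BFS ordering every vertex outside \<open>\<tau>\<close> counts as coming later, hence \<open>c\<close>
  ranges over all vertices not listed up to position \<open>j\<close>.
\<close>

definition bfs_prefix :: "'a pair_pre_digraph \<Rightarrow> 'a list \<Rightarrow> bool" where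
  "bfs_prefix G \<tau> \<longleftrightarrow> distinct \<tau> \<and> set \<tau> \<subseteq> pverts G \<and>
     (\<forall>i j c. i < j \<and> j < length \<tau> \<and> c \<in> pverts G - set (take (Suc j) \<tau>) \<and>
        (\<tau> ! i, c) \<in> parcs G \<and> (\<tau> ! i, \<tau> ! j) \<notin> parcs G \<longrightarrow> (\<exists>k<i. (\<tau> ! k, \<tau> ! j) \<in> parcs G))"

text \<open>The queue rule of BFS: append a neighbour of the earliest listed vertex that still has
  an unlisted neighbour.\<close>

lemma bfs_prefix_snoc:
  assumes G: "pair_graph G" "connected (with_proj G)"
    and \<tau>: "bfs_prefix G \<tau>" "\<tau> \<noteq> []" "set \<tau> \<noteq> pverts G"
  shows "\<exists>v\<in>pverts G - set \<tau>. bfs_prefix G (\<tau> @ [v])"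
proof -
  have \<tau>V: "set \<tau> \<subseteq> pverts G" using \<tau>(1) by (simp add: bfs_prefix_def)
  then obtain b where b: "b \<in> pverts G" "b \<notin> set \<tau>" using \<tau>(3) by auto
  define A where "A = (\<lambda>i. i < length \<tau> \<and> (\<exists>v\<in>pverts G - set \<tau>. (\<tau> ! i, v) \<in> parcs G))"
  have "hd \<tau> \<in> set \<tau>" "hd \<tau> \<in> pverts G" using \<tau>(2) \<tau>V by auto
  from cut_edge[OF G this b] have "\<exists>i. A i"
    unfolding A_def by (metis in_set_conv_nth)
  define m where "m = (LEAST i. A i)"
  have "A m" unfolding m_def using \<open>\<exists>i. A i\<close> by (rule LeastI_ex)
  then obtain v where m: "m < length \<tau>" and v: "v \<in> pverts G - set \<tau>" "(\<tau> ! m, v) \<in> parcs G"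
    by (auto simp: A_def)
  have "\<exists>k<i. ((\<tau> @ [v]) ! k, (\<tau> @ [v]) ! j) \<in> parcs G"
    if *: "i < j" "j < length (\<tau> @ [v])" "c \<in> pverts G - set (take (Suc j) (\<tau> @ [v]))"
      "((\<tau> @ [v]) ! i, c) \<in> parcs G" "((\<tau> @ [v]) ! i, (\<tau> @ [v]) ! j) \<notin> parcs G" for i j c
  proof (cases "j = length \<tau>")
    case True
    with * have i: "i < length \<tau>" "(\<tau> ! i, v) \<notin> parcs G" "(\<tau> ! i, c) \<in> parcs G"
      "c \<in> pverts G - set \<tau>" by (auto simp: nth_append)
    \<comment> \<open>The vertex at position \<open>i\<close> still has the unlisted neighbour
      \<open>c\<close>, so minimality gives \<open>m \<le> i\<close>. Equality fails because only
      the vertex at \<open>m\<close> is known to see \<open>v\<close>, whereas the one at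
      \<open>i\<close> does not; hence \<open>m\<close> is the required earlier index.\<close>
    then have "m \<le> i" unfolding m_def by (intro Least_le) (auto simp: A_def)
    moreover have "m \<noteq> i" using i v by blast
    ultimately show ?thesis using True v m by (intro exI[of _ m]) (auto simp: nth_append)
  next
    case False
    \<comment> \<open>For old positions the range of \<open>c\<close> depends only on the first
      \<open>Suc j\<close> entries, so appending \<open>v\<close> leaves the condition
      unchanged.\<close>
    with * have "i < j" "j < length \<tau>" "c \<in> pverts G - set (take (Suc j) \<tau>)"
      "(\<tau> ! i, c) \<in> parcs G" "(\<tau> ! i, \<tau> ! j) \<notin> parcs G" by (auto simp: nth_append)
    moreover from this obtain k where "k < i" "(\<tau> ! k, \<tau> ! j) \<in> parcs G"
      using \<tau>(1) unfolding bfs_prefix_def by blast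
    ultimately show ?thesis by (intro exI[of _ k]) (auto simp: nth_append)
  qed
  then show ?thesis using v \<tau>(1) by (intro bexI[of _ v]) (auto simp: bfs_prefix_def)
qed

text \<open>Once all vertices are listed, lying outside the first \<open>Suc j\<close> entries means
  coming after position \<open>j\<close>, and the prefix condition becomes the BFS
  condition.\<close>

lemma bfs_prefix_extend:
  assumes G: "pair_graph G" "connected (with_proj G)" and \<tau>: "bfs_prefix G \<tau>" "\<tau> \<noteq> []"
  shows "\<exists>\<rho>. bfs_ordering G (\<tau> @ \<rho>)"
proof -
  interpret pair_graph G by fact
  have "\<exists>\<rho>. (bfs_prefix G (\<tau> @ \<rho>) \<and> \<tau> @ \<rho> \<noteq> []) \<and> set (\<tau> @ \<rho>) = pverts G"
  proof (rule extend_to_enumeration)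
    fix \<tau> assume "bfs_prefix G \<tau> \<and> \<tau> \<noteq> []" "set \<tau> \<noteq> pverts G"
    then show "\<exists>v\<in>pverts G - set \<tau>. bfs_prefix G (\<tau> @ [v]) \<and> \<tau> @ [v] \<noteq> []"
      using bfs_prefix_snoc[OF G, of \<tau>] by simp
  qed (use \<tau> in \<open>auto simp: bfs_prefix_def\<close>)
  then obtain \<rho> where \<rho>: "bfs_prefix G (\<tau> @ \<rho>)" "set (\<tau> @ \<rho>) = pverts G" by blast
  define \<sigma> where "\<sigma> = \<tau> @ \<rho>"
  have dist: "distinct \<sigma>" and V: "set \<sigma> = pverts G" using \<rho> by (auto simp: \<sigma>_def bfs_prefix_def)
  have "\<exists>d. precedes \<sigma> d a \<and> (d, b) \<in> parcs G"
    if abc: "precedes \<sigma> a b" "precedes \<sigma> b c" "(a, c) \<in> parcs G" "(a, b) \<notin> parcs G" for a b c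
  proof -
    obtain i j l where ijl: "i < j" "j < l" "l < length \<sigma>" "a = \<sigma> ! i" "b = \<sigma> ! j" "c = \<sigma> ! l"
      using abc(1,2) dist by (auto elim!: precedesE simp: nth_eq_iff_index_eq)
    then have "c \<in> pverts G - set (take (Suc j) \<sigma>)"
      using dist V nth_mem[of l \<sigma>] by (simp add: nth_mem_take_iff)
    moreover have "j < length \<sigma>" using ijl by simp
    ultimately obtain k where "k < i" "(\<sigma> ! k, \<sigma> ! j) \<in> parcs G"
      using \<rho>(1) ijl abc(3,4) unfolding bfs_prefix_def \<sigma>_def[symmetric] by blast
    then show ?thesis using ijl dist by (intro exI[of _ "\<sigma> ! k"]) (simp add: precedes_nth)
  qed
  then have "bfs_ordering G \<sigma>"
    using dist V unfolding bfs_ordering_def vertex_ordering_def by blast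
  then show ?thesis unfolding \<sigma>_def by blast
qed

section \<open>Orderings with three prescribed initial vertices\<close>

lemma precedes_from_prefix:
  assumes "vertex_ordering G ([p, q, r] @ \<rho>)" "z \<in> pverts G" "z \<notin> {p, q, r}"
  shows "precedes ([p, q, r] @ \<rho>) r z"
proof -
  have "z \<in> set \<rho>" using assms by (auto simp: vertex_ordering_def)
  then obtain n where "n < length \<rho>" "z = \<rho> ! n" by (auto simp: in_set_conv_nth)
  then show ?thesis unfolding precedes_def
    by (intro exI[of _ 2] exI[of _ "n + 3"]) (auto simp: nth_append)
qed

lemma precedes_prefix_cases:
  assumes "distinct ([p, q, r] @ \<rho>)"
  shows "precedes ([p, q, r] @ \<rho>) d p \<longleftrightarrow> False"
    "precedes ([p, q, r] @ \<rho>) d q \<longleftrightarrow> d = p"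
    "precedes ([p, q, r] @ \<rho>) d r \<longleftrightarrow> d = p \<or> d = q"
proof -
  let ?\<sigma> = "[p, q, r] @ \<rho>"
  note * = precedes_nth_right[OF assms, of _ d]
  show "precedes ?\<sigma> d p \<longleftrightarrow> False" using *[of 0] by simp
  show "precedes ?\<sigma> d q \<longleftrightarrow> d = p" using *[of 1] by simp
  show "precedes ?\<sigma> d r \<longleftrightarrow> d = p \<or> d = q" using *[of 2] by (auto simp: less_2_cases_iff)
qed

text \<open>The list \<open>[u, x, y]\<close> is a legal BFS start: its only nonadjacent pair is
  \<open>x\<close>, \<open>y\<close>, and \<open>u\<close> is an earlier neighbour of
  \<open>y\<close>. The DFS condition for \<open>x\<close>, \<open>y\<close>, \<open>z\<close> fails
  because nothing lies between \<open>x\<close> and \<open>y\<close>.\<close>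

lemma extendable_cherry_bfs_not_dfs:
  assumes G: "pair_graph G" "connected (with_proj G)" and Q: "extendable_cherry G u x y z"
  shows "\<exists>\<sigma>. bfs_ordering G \<sigma> \<and> \<not> dfs_ordering G \<sigma>"
proof -
  have V: "{u, x, y, z} \<subseteq> pverts G"
    using Q parcs_in_pverts[OF G(1)] by (auto simp: extendable_cherry_def)
  have "bfs_prefix G [u, x, y]"
    using Q V unfolding bfs_prefix_def extendable_cherry_def
    by (auto simp: less_Suc_eq numeral_3_eq_3 nth_Cons')
  then obtain \<rho> where \<rho>: "bfs_ordering G ([u, x, y] @ \<rho>)"
    using bfs_prefix_extend[OF G] by blast
  then have \<sigma>: "vertex_ordering G ([u, x, y] @ \<rho>)" by (simp add: bfs_ordering_def)
  then have dist: "distinct ([u, x, y] @ \<rho>)" by (simp add: vertex_ordering_def)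
  have "precedes ([u, x, y] @ \<rho>) y z"
    using Q V by (intro precedes_from_prefix[OF \<sigma>]) (auto simp: extendable_cherry_def)
  moreover have "\<not> (precedes ([u, x, y] @ \<rho>) x d \<and> precedes ([u, x, y] @ \<rho>) d y)" for d
    using precedes_prefix_cases[OF dist] dist by (auto simp del: append.simps)
  ultimately have "\<not> dfs_ordering G ([u, x, y] @ \<rho>)"
    using Q precedes_prefix_cases(3)[OF dist] unfolding dfs_ordering_def extendable_cherry_def
    by blast
  with \<rho> show ?thesis by blast
qed

text \<open>Starting with \<open>x\<close> leaves no vertex before it, so the BFS condition for
  \<open>x\<close>, \<open>y\<close>, \<open>z\<close> has no witness. The start is attached because
  \<open>u\<close> is adjacent to both \<open>x\<close> and \<open>y\<close>.\<close>

lemma extendable_cherry_search_not_bfs: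
  assumes G: "pair_graph G" "connected (with_proj G)" and Q: "extendable_cherry G u x y z"
  shows "\<exists>\<sigma>. search_ordering G \<sigma> \<and> \<not> bfs_ordering G \<sigma>"
proof -
  have V: "{u, x, y, z} \<subseteq> pverts G"
    using Q parcs_in_pverts[OF G(1)] by (auto simp: extendable_cherry_def)
  have "attached_list G [x, u, y]"
    using Q V parcs_sym[OF G(1), of x u] unfolding attached_list_def extendable_cherry_def
    by (auto simp: less_Suc_eq numeral_3_eq_3 nth_Cons')
  then obtain \<rho> where \<rho>: "search_ordering G ([x, u, y] @ \<rho>)"
    using attached_list_extend[OF G] by blast
  then have \<sigma>: "vertex_ordering G ([x, u, y] @ \<rho>)" by (simp add: search_ordering_def)
  then have dist: "distinct ([x, u, y] @ \<rho>)" by (simp add: vertex_ordering_def)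
  have "precedes ([x, u, y] @ \<rho>) y z"
    using Q V by (intro precedes_from_prefix[OF \<sigma>]) (auto simp: extendable_cherry_def)
  then have "\<not> bfs_ordering G ([x, u, y] @ \<rho>)"
    using Q precedes_prefix_cases(1,3)[OF dist] unfolding bfs_ordering_def extendable_cherry_def
    by blast
  with \<rho> show ?thesis by blast
qed

theorem theorem1:
  fixes G :: "'a pair_pre_digraph"
  assumes "pair_graph G" and "Digraph_Component.connected (with_proj G)"
  defines "A1 \<equiv> free_of {P4_graph, C4_graph, paw_graph, diamond_graph} G"
      and "A2 \<equiv> \<forall>\<sigma>. search_ordering G \<sigma> \<longrightarrow> dfs_ordering G \<sigma>"
      and "A3 \<equiv> \<forall>\<sigma>. search_ordering G \<sigma> \<longrightarrow> bfs_ordering G \<sigma>"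
      and "A4 \<equiv> \<forall>\<sigma>. vertex_ordering G \<sigma> \<longrightarrow> (bfs_ordering G \<sigma> \<longleftrightarrow> dfs_ordering G \<sigma>)"
  shows "(A1 \<longleftrightarrow> A2) \<and> (A2 \<longleftrightarrow> A3) \<and> (A3 \<longleftrightarrow> A4)"
proof (cases "\<exists>u x y z. extendable_cherry G u x y z")
  \<comment> \<open>With the pattern present all four statements fail; without it all four
    hold.\<close>
  case True
  then have "\<not> A1" using not_free_iff_extendable_cherry[OF assms(1)] by (simp add: A1_def)
  moreover obtain \<sigma> where \<sigma>: "bfs_ordering G \<sigma>" "\<not> dfs_ordering G \<sigma>"
    using True extendable_cherry_bfs_not_dfs[OF assms(1,2)] by blast
  \<comment> \<open>On a connected graph the BFS ordering \<open>\<sigma>\<close> is a search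
    ordering, so it refutes \<open>A2\<close> as well as \<open>A4\<close>.\<close>
  then have "\<not> A2" unfolding A2_def using bfs_imp_search_ordering[OF assms(1,2)] by blast
  moreover have "\<not> A4" unfolding A4_def using \<sigma> by (auto simp: bfs_ordering_def)
  moreover have "\<not> A3"
    unfolding A3_def using True extendable_cherry_search_not_bfs[OF assms(1,2)] by blast
  ultimately show ?thesis by blast
next
  case False
  then have "A1" using not_free_iff_extendable_cherry[OF assms(1)] by (auto simp: A1_def)
  moreover have both: "bfs_ordering G \<sigma> \<and> dfs_ordering G \<sigma>" if "search_ordering G \<sigma>" for \<sigma>
  proof -
    have "vertex_ordering G \<sigma>" using that by (simp add: search_ordering_def)
    with False show ?thesis
      using search_ordering_extendable_cherry[OF assms(1) that]
      unfolding bfs_ordering_def dfs_ordering_def by blast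
  qed
  then have "A2" "A3" by (auto simp: A2_def A3_def)
  \<comment> \<open>A BFS or a DFS ordering is a search ordering, and every search ordering is now
    of both kinds.\<close>
  moreover have "A4" unfolding A4_def
    using both bfs_imp_search_ordering[OF assms(1,2)] dfs_imp_search_ordering[OF assms(1,2)]
    by blast
  ultimately show ?thesis by blast
qed

end
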